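(* For $r\ge 2$ and $0<y<1$, $$G_r(y) = \frac{\sqrt{y}}{2\pi} \int_{0}^1 G_{r-1}(yv) \frac{dv}{\sqrt{(1-v)(1-yv)}}.$$
   Context: Let $X_1,\dots,X_r$ be independent random variables uniformly distributed on the complex unit circle, and let $\hat p_r$ be the probability density of $(X_1+X_1^{-1})\cdots(X_r+X_r^{-1})$ (taken to be the version continuous on $(0,2^r)$; it is even and supported in $[-2^r,2^r]$). Define $G_r$ by $\hat p_r(x)=G_r\left(1-\frac{x^2}{4^r}\right)$, i.e. $G_r(y)=\hat p_r(2^r\sqrt{1-y})$ for $0<y<1$. For example $G_1(y)=\frac{1}{2\pi\sqrt y}$ for $0<y\le1$. *)

theory Defs
  imports "HOL-Probability.Probability"
begin

definition unit_circle_uniform :: "complex measure" where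
  "unit_circle_uniform = distr (uniform_measure lborel {0..2 * pi}) borel cis"

lemma prob_space_unit_circle_uniform: "prob_space unit_circle_uniform"
proof -
  have "prob_space (uniform_measure lborel {0..2 * pi :: real})"
    by (rule prob_space_uniform_measure) (auto simp: ennreal_eq_0_iff not_le pi_gt_zero)
  moreover have "cis \<in> borel_measurable (uniform_measure lborel {0..2 * pi})"
    by (auto intro!: borel_measurable_continuous_onI continuous_on_cis continuous_on_id
        simp: measurable_cong_sets[OF sets_uniform_measure refl])
  ultimately show ?thesis
    unfolding unit_circle_uniform_def by (rule prob_space.prob_space_distr)
qed

text \<open>
  The product \<open>(X 1 + 1 / X 1) \<cdots> (X r + 1 / X r)\<close> as a real random variable. On the unit circle
  each factor is real, so taking the real part only changes the type.
\<close>

definition circle_prod :: "(nat \<Rightarrow> 'a \<Rightarrow> complex) \<Rightarrow> nat \<Rightarrow> 'a \<Rightarrow> real" where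
  "circle_prod X r \<omega> = Re (\<Prod>i = 1..r. X i \<omega> + inverse (X i \<omega>))"

lemma circle_prod_eq:
  assumes "\<And>i. i \<in> {1..r} \<Longrightarrow> norm (X i \<omega>) = 1"
  shows "complex_of_real (circle_prod X r \<omega>) = (\<Prod>i = 1..r. X i \<omega> + inverse (X i \<omega>))"
proof -
  have "X i \<omega> + inverse (X i \<omega>) = of_real (2 * Re (X i \<omega>))" if "i \<in> {1..r}" for i
  proof -
    have "X i \<omega> * cnj (X i \<omega>) = 1"
      using assms[OF that] by (simp add: complex_norm_square[symmetric])
    then have "inverse (X i \<omega>) = cnj (X i \<omega>)"
      by (rule inverse_unique)
    then show ?thesis by (simp add: complex_add_cnj)
  qed
  then have "(\<Prod>i = 1..r. X i \<omega> + inverse (X i \<omega>)) = (\<Prod>i = 1..r. of_real (2 * Re (X i \<omega>)))"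
    by (rule prod.cong[OF refl])
  then have "(\<Prod>i = 1..r. X i \<omega> + inverse (X i \<omega>)) = of_real (\<Prod>i = 1..r. 2 * Re (X i \<omega>))"
    by simp
  then show ?thesis by (simp add: circle_prod_def del: of_real_prod)
qed

definition is_hat_p ::
  "'a measure \<Rightarrow> (nat \<Rightarrow> 'a \<Rightarrow> complex) \<Rightarrow> nat \<Rightarrow> (real \<Rightarrow> real) \<Rightarrow> bool" where
  "is_hat_p M X r p \<longleftrightarrow>
     distributed M lborel (circle_prod X r) (\<lambda>x. ennreal (p x)) \<and>
     (\<forall>x. 0 \<le> p x) \<and>
     continuous_on {0<..<2 ^ r} p \<and>
     (\<forall>x. p (- x) = p x) \<and>
     (\<forall>x. 2 ^ r < \<bar>x\<bar> \<longrightarrow> p x = 0)"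

text \<open>
  A density is determined almost everywhere, so continuity determines it at every point of
  \<open>(0, 2 ^ r)\<close>. The choice below is therefore arbitrary only at \<open>0\<close> and \<open>\<plusminus> 2 ^ r\<close>.
\<close>

definition hat_p :: "'a measure \<Rightarrow> (nat \<Rightarrow> 'a \<Rightarrow> complex) \<Rightarrow> nat \<Rightarrow> real \<Rightarrow> real" where
  "hat_p M X r = (SOME p. is_hat_p M X r p)"

text \<open>Only the values for \<open>0 < y < 1\<close> are meaningful.\<close>

definition G :: "'a measure \<Rightarrow> (nat \<Rightarrow> 'a \<Rightarrow> complex) \<Rightarrow> nat \<Rightarrow> real \<Rightarrow> real" where
  "G M X r y = hat_p M X r (2 ^ r * sqrt (1 - y))"

end

theory Submission
  imports Defs
begin

text \<open>
  Multiplying by one more factor \<open>2 cos \<theta>\<close> turns the density \<open>p\<close> into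
  \<open>x \<mapsto> \<integral> p z q (x / z) / \<bar>z\<bar> dz\<close>, where \<open>q\<close> is the arcsine density on \<open>(- 2, 2)\<close>. For
  \<open>p z = h (1 - (z / N)\<^sup>2)\<close> with support \<open>[- N, N]\<close> and \<open>x\<^sup>2 = 4 N\<^sup>2 (1 - y)\<close>, the substitution
  \<open>z\<^sup>2 = N\<^sup>2 (1 - y v)\<close> makes this the stated integral of \<open>h\<close>. Iterating from \<open>G\<^sub>1\<close> therefore
  gives densities of the products; they are the continuous versions because the integral
  operator preserves continuity on \<open>(0, 1)\<close> together with bounds \<open>h y \<le> C / sqrt y\<close> on every
  \<open>(0, b]\<close> with \<open>b < 1\<close>, which make the integrand dominated by a multiple of
  \<open>1 / sqrt (v (1 - v))\<close>. Continuous densities are unique, so they agree with \<open>G\<close>.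
\<close>

subsection \<open>The integral operator\<close>

text \<open>The antiderivative \<open>arcsin (2 * v - 1)\<close> is continuous up to both endpoints,
  so the integral of this nonnegative kernel converges although the kernel is unbounded
  there.\<close>

lemma integrable_arcsine_kernel:
  "set_integrable lborel {0<..<1} (\<lambda>v::real. 1 / sqrt (v * (1 - v)))"
proof -
  let ?F = "\<lambda>v::real. arcsin (2 * v - 1)"
  have "set_integrable lborel (einterval (ereal 0) (ereal 1)) (\<lambda>v::real. 1 / sqrt (v * (1 - v)))"
  proof (rule interval_integral_FTC_nonneg(1))
    fix x :: real
    assume x: "ereal 0 < ereal x" "ereal x < ereal 1"
    have "1 - (2 * x - 1)\<^sup>2 = 2\<^sup>2 * (x * (1 - x))"
      by (simp add: power2_eq_square algebra_simps)
    then have "sqrt (1 - (2 * x - 1)\<^sup>2) = 2 * sqrt (x * (1 - x))"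
      by (simp add: real_sqrt_mult)
    then show "DERIV ?F x :> 1 / sqrt (x * (1 - x))"
      using x by (auto intro!: derivative_eq_intros simp: field_simps)
    show "isCont (\<lambda>v. 1 / sqrt (v * (1 - v))) x"
      using x by (intro continuous_intros) auto
  next
    have cont: "continuous_on {0..1} ?F"
      by (intro continuous_intros) auto
    have "(?F \<longlongrightarrow> ?F 0) (at 0 within {0..1})" "(?F \<longlongrightarrow> ?F 1) (at 1 within {0..1})"
      using cont[unfolded continuous_on_def] by (fastforce simp del: arcsin_minus_1 arcsin_1)+
    then show "((?F \<circ> real_of_ereal) \<longlongrightarrow> ?F 0) (at_right (ereal 0))"
      "((?F \<circ> real_of_ereal) \<longlongrightarrow> ?F 1) (at_left (ereal 1))"
      by (simp_all add: ereal_tendsto_simps1 at_within_Icc_at_right at_within_Icc_at_left)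
  qed auto
  then show ?thesis by (simp add: greaterThanLessThan_def einterval_eq)
qed

definition beta_kernel :: "(real \<Rightarrow> real) \<Rightarrow> real \<Rightarrow> real \<Rightarrow> real" where
  "beta_kernel h y v = h (y * v) * (1 / sqrt ((1 - v) * (1 - y * v)))"

definition transform :: "(real \<Rightarrow> real) \<Rightarrow> real \<Rightarrow> real" where
  "transform h y = sqrt y / (2 * pi) * (LBINT v:{0<..<1}. beta_kernel h y v)"

text \<open>The class of profiles in which the iteration stays. The singularity allowed at 0 is that
  of \<open>arcsine_profile\<close>; no bound is imposed near 1, because already
  \<open>transform arcsine_profile\<close> diverges logarithmically there.\<close>

definition tame :: "(real \<Rightarrow> real) \<Rightarrow> bool" where
  "tame h \<longleftrightarrow> continuous_on {0<..<1} h \<and> (\<forall>y. 0 < y \<longrightarrow> y < 1 \<longrightarrow> 0 \<le> h y) \<and>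
     (\<forall>b<1. \<exists>C\<ge>0. \<forall>y. 0 < y \<longrightarrow> y \<le> b \<longrightarrow> h y \<le> C / sqrt y)"

lemma mult_in_unit:
  fixes y v :: real
  assumes "0 < y" "y < 1" "0 < v" "v < 1"
  shows "0 < y * v" "y * v < 1" "y * v < y"
  using assms mult_strict_mono[of y 1 v 1] mult_strict_left_mono[of v 1 y] by auto

lemma tame_nonneg: "tame h \<Longrightarrow> 0 < y \<Longrightarrow> y < 1 \<Longrightarrow> 0 \<le> h y"
  by (simp add: tame_def)

lemma beta_kernel_nonneg:
  assumes "tame h" "0 < y" "y < 1" "0 < v" "v < 1"
  shows "0 \<le> beta_kernel h y v"
  using assms mult_in_unit[of y v] by (simp add: beta_kernel_def tame_nonneg)

lemma beta_kernel_measurable: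
  assumes "tame h" "0 < y" "y < 1"
  shows "set_borel_measurable lborel {0<..<1} (beta_kernel h y)"
proof -
  have h: "continuous_on {0<..<1} h" using assms by (simp add: tame_def)
  have "continuous_on {0<..<1} (\<lambda>v. h (y * v))"
    by (rule continuous_on_compose2[OF h]) (use assms mult_in_unit in \<open>auto intro!: continuous_intros\<close>)
  then have "continuous_on {0<..<1} (beta_kernel h y)"
    unfolding beta_kernel_def using assms
    by (intro continuous_intros) (use mult_in_unit(2)[OF assms(2,3)] in force)+
  then show ?thesis
    unfolding set_borel_measurable_def
    by (auto intro!: borel_measurable_continuous_on_indicator simp del: real_scaleR_def)
qed

text \<open>The bound on \<open>h (y * v)\<close> supplies the factor \<open>1 / sqrt v\<close>, and
  \<open>1 - y * v\<close> stays above \<open>1 - b\<close>. What remains singular in v is the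
  arcsine kernel, with C uniform in \<open>y \<le> b\<close>.\<close>

lemma beta_kernel_bound:
  assumes "tame h" "b < 1"
  obtains C where "C \<ge> 0"
    "\<And>y v. 0 < y \<Longrightarrow> y \<le> b \<Longrightarrow> 0 < v \<Longrightarrow> v < 1 \<Longrightarrow> beta_kernel h y v \<le> C / sqrt y * (1 / sqrt (v * (1 - v)))"
proof -
  obtain C where C: "C \<ge> 0" "\<And>y. 0 < y \<Longrightarrow> y \<le> b \<Longrightarrow> h y \<le> C / sqrt y"
    using assms unfolding tame_def by blast
  show ?thesis
  proof (rule that[of "C / sqrt (1 - b)"])
    show "0 \<le> C / sqrt (1 - b)" using C assms by simp
    fix y v assume yv: "0 < y" "y \<le> b" "0 < v" "v < (1::real)"
    have m: "0 < y * v" "y * v < 1" "y * v < y" using mult_in_unit[of y v] yv assms by auto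
    have "h (y * v) \<le> C / sqrt (y * v)" using yv assms m by (intro C(2)) linarith+
    moreover have "1 / sqrt ((1 - v) * (1 - y * v)) \<le> 1 / sqrt ((1 - v) * (1 - b))"
      using yv assms m by (intro divide_left_mono real_sqrt_le_mono mult_left_mono) auto
    ultimately have "beta_kernel h y v \<le> C / sqrt (y * v) * (1 / sqrt ((1 - v) * (1 - b)))"
      unfolding beta_kernel_def using yv assms m C(1) by (intro mult_mono) auto
    also have "\<dots> = C / sqrt (1 - b) / sqrt y * (1 / sqrt (v * (1 - v)))"
      by (simp add: real_sqrt_mult)
    finally show "beta_kernel h y v \<le> C / sqrt (1 - b) / sqrt y * (1 / sqrt (v * (1 - v)))" .
  qed
qed

lemma beta_kernel_integrable:
  assumes "tame h" "0 < y" "y < 1"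
  shows "set_integrable lborel {0<..<1} (beta_kernel h y)"
proof -
  obtain C where C: "C \<ge> 0" "\<And>v. 0 < v \<Longrightarrow> v < 1 \<Longrightarrow> beta_kernel h y v \<le> C / sqrt y * (1 / sqrt (v * (1 - v)))"
    using beta_kernel_bound[of h y] assms by (metis order_refl)
  have "set_integrable lborel {0<..<1} (\<lambda>v. C / sqrt y * (1 / sqrt (v * (1 - v))))"
    by (intro set_integrable_mult_right integrable_arcsine_kernel)
  then show ?thesis
    by (rule set_integrable_bound)
      (use C(2) beta_kernel_nonneg[OF assms] beta_kernel_measurable[OF assms]
        in \<open>auto intro!: AE_I2 order_trans[OF _ abs_ge_self] simp del: abs_divide abs_mult\<close>)
qed

text \<open>On \<open>{a..b}\<close> with \<open>0 < a\<close> the factor \<open>1 / sqrt y\<close>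
  is at most \<open>1 / sqrt a\<close>. This gives one integrable majorant for all y, so dominated
  convergence along sequences applies.\<close>

lemma transform_continuous:
  assumes "tame h"
  shows "continuous_on {0<..<1} (transform h)"
proof -
  have *: "continuous_on {a..b} (transform h)" if ab: "0 < a" "b < 1" for a b
  proof -
    obtain C where C: "C \<ge> 0" "\<And>y v. 0 < y \<Longrightarrow> y \<le> b \<Longrightarrow> 0 < v \<Longrightarrow> v < 1
        \<Longrightarrow> beta_kernel h y v \<le> C / sqrt y * (1 / sqrt (v * (1 - v)))"
      using beta_kernel_bound[OF assms ab(2)] by metis
    have "continuous_on {a..b} (\<lambda>y. LBINT v:{0<..<1}. beta_kernel h y v)"
    proof (rule continuous_on_sequentiallyI)
      fix u y assume u: "\<forall>n. u n \<in> {a..b}" and y: "y \<in> {a..b}" and lim: "u \<longlonglongrightarrow> y"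
      show "(\<lambda>n. LBINT v:{0<..<1}. beta_kernel h (u n) v) \<longlonglongrightarrow> (LBINT v:{0<..<1}. beta_kernel h y v)"
        unfolding set_lebesgue_integral_def
      proof (rule integral_dominated_convergence)
        show "integrable lborel (\<lambda>v. indicat_real {0<..<1} v *\<^sub>R (C / sqrt a * (1 / sqrt (v * (1 - v)))))"
          using set_integrable_mult_right[OF integrable_arcsine_kernel, of "C / sqrt a"]
          by (simp add: set_integrable_def)
        have meas: "(\<lambda>v. indicat_real {0<..<1} v *\<^sub>R beta_kernel h z v) \<in> borel_measurable lborel"
          if "z \<in> {a..b}" for z
          using beta_kernel_measurable[OF assms, of z] that ab by (auto simp: set_borel_measurable_def)
        show "(\<lambda>v. indicat_real {0<..<1} v *\<^sub>R beta_kernel h y v) \<in> borel_measurable lborel"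
          using meas y by blast
        show "(\<lambda>v. indicat_real {0<..<1} v *\<^sub>R beta_kernel h (u n) v) \<in> borel_measurable lborel" for n
          using meas y u by blast+
        show "AE v in lborel. (\<lambda>n. indicat_real {0<..<1} v *\<^sub>R beta_kernel h (u n) v)
            \<longlonglongrightarrow> indicat_real {0<..<1} v *\<^sub>R beta_kernel h y v"
        proof (intro AE_I2)
          fix v :: real
          show "(\<lambda>n. indicat_real {0<..<1} v *\<^sub>R beta_kernel h (u n) v)
            \<longlonglongrightarrow> indicat_real {0<..<1} v *\<^sub>R beta_kernel h y v"
          proof (cases "v \<in> {0<..<1}")
            case True
            then have m: "y * v \<in> {0<..<1}" using y ab mult_in_unit[of y v] by auto
            have "isCont h (y * v)"
              using assms m by (auto simp: tame_def continuous_on_eq_continuous_at)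
            then have "(\<lambda>n. h (u n * v)) \<longlonglongrightarrow> h (y * v)"
              using isCont_tendsto_compose lim tendsto_mult_right by blast
            then show ?thesis
              unfolding beta_kernel_def using m True lim by (auto intro!: tendsto_intros)
          qed simp
        qed
        show "AE v in lborel. norm (indicat_real {0<..<1} v *\<^sub>R beta_kernel h (u n) v)
            \<le> indicat_real {0<..<1} v *\<^sub>R (C / sqrt a * (1 / sqrt (v * (1 - v))))" for n
        proof (intro AE_I2)
          fix v :: real
          have un: "a \<le> u n" "0 < u n" "u n \<le> b" using u ab by (auto intro: less_le_trans)
          have "C / sqrt (u n) * (1 / sqrt (v * (1 - v))) \<le> C / sqrt a * (1 / sqrt (v * (1 - v)))"
            if "0 < v" "v < 1"
            using un C(1) ab that by (intro mult_right_mono divide_left_mono) auto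
          then show "norm (indicat_real {0<..<1} v *\<^sub>R beta_kernel h (u n) v)
            \<le> indicat_real {0<..<1} v *\<^sub>R (C / sqrt a * (1 / sqrt (v * (1 - v))))"
            using C(2)[OF un(2,3), of v] beta_kernel_nonneg[OF assms, of "u n" v] un ab
            by (auto simp: indicator_def)
        qed
      qed
    qed
    then show ?thesis
      unfolding transform_def by (intro continuous_intros) auto
  qed
  have "isCont (transform h) x" if x: "x \<in> {0<..<1}" for x
  proof -
    \<comment> \<open>The endpoints lie halfway from x to 0 and to 1, which makes a compact
      neighbourhood of x inside the unit interval.\<close>
    have "continuous_on {x / 2..(1 + x) / 2} (transform h)" using x by (intro *) auto
    moreover have "x \<in> interior {x / 2..(1 + x) / 2}" using x by (auto simp: interior_atLeastAtMost_real)
    ultimately show ?thesis by (rule continuous_on_interior)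
  qed
  then show ?thesis by (simp add: continuous_at_imp_continuous_on)
qed

text \<open>The prefactor \<open>sqrt y\<close> cancels the \<open>1 / sqrt y\<close> of the kernel
  bound, so \<open>transform h\<close> is even bounded on each (0, b]. Dividing that bound by
  \<open>sqrt y < 1\<close> only weakens it.\<close>

lemma tame_transform:
  assumes "tame h"
  shows "tame (transform h)"
  unfolding tame_def
proof (intro conjI allI impI)
  show "continuous_on {0<..<1} (transform h)" using assms by (rule transform_continuous)
next
  fix y :: real assume "0 < y" "y < 1"
  then show "0 \<le> transform h y"
    unfolding transform_def set_lebesgue_integral_def
    by (intro mult_nonneg_nonneg integral_nonneg_AE AE_I2)
      (use beta_kernel_nonneg[OF assms, of y] in \<open>auto simp: indicator_def\<close>)
next
  fix b :: real assume b: "b < 1"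
  let ?J = "LBINT v:{0<..<1}. 1 / sqrt (v * (1 - v))"
  have J: "0 \<le> ?J"
    unfolding set_lebesgue_integral_def
    by (intro integral_nonneg_AE AE_I2) (auto simp: indicator_def)
  obtain C where C: "C \<ge> 0" "\<And>y v. 0 < y \<Longrightarrow> y \<le> b \<Longrightarrow> 0 < v \<Longrightarrow> v < 1
      \<Longrightarrow> beta_kernel h y v \<le> C / sqrt y * (1 / sqrt (v * (1 - v)))"
    using beta_kernel_bound[OF assms b] by metis
  have "transform h y \<le> C * ?J / (2 * pi) / sqrt y" if y: "0 < y" "y \<le> b" for y
  proof -
    have "(LBINT v:{0<..<1}. beta_kernel h y v) \<le> (LBINT v:{0<..<1}. C / sqrt y * (1 / sqrt (v * (1 - v))))"
      using y b C(2)[OF y]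
      by (intro set_integral_mono beta_kernel_integrable assms set_integrable_mult_right
          integrable_arcsine_kernel) auto
    also have "\<dots> = C / sqrt y * ?J" by (rule set_integral_mult_right)
    finally have "transform h y \<le> sqrt y / (2 * pi) * (C / sqrt y * ?J)"
      unfolding transform_def using y by (intro mult_left_mono) auto
    also have "\<dots> = C * ?J / (2 * pi) / 1" using y by simp
    also have "\<dots> \<le> C * ?J / (2 * pi) / sqrt y"
      using y b C(1) J by (intro divide_left_mono) auto
    finally show ?thesis .
  qed
  then show "\<exists>C\<ge>0. \<forall>y. 0 < y \<longrightarrow> y \<le> b \<longrightarrow> transform h y \<le> C / sqrt y"
    using C(1) J by (intro exI[of _ "C * ?J / (2 * pi)"]) simp
qed

subsection \<open>Densities of products\<close>

text \<open>The point 0 is excluded because there the argument of h would be 1, where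
  \<open>tame\<close> says nothing. With the value 0 there and outside the support, nonnegativity
  and measurability hold on the whole line.\<close>

definition even_density :: "real \<Rightarrow> (real \<Rightarrow> real) \<Rightarrow> real \<Rightarrow> real" where
  "even_density N h x = (if 0 < \<bar>x\<bar> \<and> \<bar>x\<bar> < N then h (1 - (x / N)\<^sup>2) else 0)"

text \<open>This is \<open>G_1\<close>: for 0 < |x| < 2,
  \<open>even_density 2 arcsine_profile x\<close> equals \<open>1 / (pi * sqrt (4 - x^2))\<close>,
  the arcsine density.\<close>

definition arcsine_profile :: "real \<Rightarrow> real" where
  "arcsine_profile y = 1 / (2 * pi * sqrt y)"

lemma tame_arcsine_profile: "tame arcsine_profile"
  unfolding tame_def arcsine_profile_def
proof (intro conjI allI impI)
  show "continuous_on {0<..<1} (\<lambda>y. 1 / (2 * pi * sqrt y))"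
    by (intro continuous_intros) auto
  show "\<exists>C\<ge>0. \<forall>y. 0 < y \<longrightarrow> y \<le> b \<longrightarrow> 1 / (2 * pi * sqrt y) \<le> C / sqrt y" for b
    by (intro exI[of _ "1 / (2 * pi)"]) auto
qed auto

lemma one_minus_square_unit:
  fixes x N :: real
  assumes "0 < \<bar>x\<bar>" "\<bar>x\<bar> < N"
  shows "0 < 1 - (x / N)\<^sup>2" "1 - (x / N)\<^sup>2 < 1"
proof -
  have "\<bar>x / N\<bar> < 1" using assms by (simp add: abs_divide)
  then show "0 < 1 - (x / N)\<^sup>2" by (simp add: abs_square_less_1)
  show "1 - (x / N)\<^sup>2 < 1" using assms by auto
qed

lemma even_density_nonneg: "tame h \<Longrightarrow> 0 \<le> even_density N h x"
  using one_minus_square_unit[of x N] by (simp add: even_density_def tame_nonneg)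

lemma even_density_minus [simp]: "even_density N h (- x) = even_density N h x"
  by (simp add: even_density_def)

lemma even_density_continuous_nonzero:
  assumes "tame h"
  shows "continuous_on {x. 0 < \<bar>x\<bar> \<and> \<bar>x\<bar> < N} (even_density N h)"
proof -
  have h: "continuous_on {0<..<1} h" using assms by (simp add: tame_def)
  have "continuous_on {x. 0 < \<bar>x\<bar> \<and> \<bar>x\<bar> < N} (\<lambda>x. h (1 - (x / N)\<^sup>2))"
    by (rule continuous_on_compose2[OF h])
      (use one_minus_square_unit in \<open>auto intro!: continuous_intros\<close>)
  then show ?thesis
    by (rule continuous_on_eq) (simp add: even_density_def)
qed

lemma even_density_continuous:
  "tame h \<Longrightarrow> continuous_on {0<..<N} (even_density N h)"
  by (rule continuous_on_subset[OF even_density_continuous_nonzero]) auto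

lemma even_density_measurable:
  assumes "tame h"
  shows "even_density N h \<in> borel_measurable borel"
proof -
  let ?S = "{x::real. 0 < \<bar>x\<bar> \<and> \<bar>x\<bar> < N}"
  have "?S \<in> sets borel" by measurable
  then have "(\<lambda>x. indicator ?S x *\<^sub>R even_density N h x) \<in> borel_measurable borel"
    using assms by (intro borel_measurable_continuous_on_indicator even_density_continuous_nonzero)
  moreover have "(\<lambda>x. indicator ?S x *\<^sub>R even_density N h x) = even_density N h"
    by (auto simp: even_density_def indicator_def)
  ultimately show ?thesis by simp
qed

section \<open>Multiplicative convolution with the arcsine density\<close>

lemma nn_integral_even:
  fixes f :: "real \<Rightarrow> ennreal"
  assumes [measurable]: "f \<in> borel_measurable borel" and even: "\<And>x. f (- x) = f x"
  shows "(\<integral>\<^sup>+x. f x \<partial>lborel) = 2 * (\<integral>\<^sup>+x. f x * indicator {..<0} x \<partial>lborel)"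
proof -
  have "(\<integral>\<^sup>+x. f x \<partial>lborel)
      = (\<integral>\<^sup>+x. f x * indicator {..<0} x + f x * indicator {0<..} x \<partial>lborel)"
    using AE_lborel_singleton[of "0::real"]
    by (intro nn_integral_cong_AE) (auto simp: indicator_def)
  also have "\<dots> = (\<integral>\<^sup>+x. f x * indicator {..<0} x \<partial>lborel) + (\<integral>\<^sup>+x. f x * indicator {0<..} x \<partial>lborel)"
    by (intro nn_integral_add) auto
  also have "(\<integral>\<^sup>+x. f x * indicator {0<..} x \<partial>lborel) = (\<integral>\<^sup>+x. f x * indicator {..<0} x \<partial>lborel)"
    by (subst nn_integral_real_affine[where c = "-1" and t = 0])
      (auto simp: even indicator_def intro!: nn_integral_cong)
  finally show ?thesis by (simp add: mult_2)
qed

text \<open>The left side is the density of a product whose second factor has the arcsine law. The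
  integrand vanishes unless |x|/2 < |z| < N, and \<open>z = - N * sqrt (1 - y * v)\<close> carries 0
  < v < 1 onto the negative half of that range.\<close>

lemma nn_integral_even_density_mult:
  assumes h: "tame h" and N: "0 < N"
  shows "(\<integral>\<^sup>+z. ennreal (even_density N h z) * ennreal (even_density 2 arcsine_profile (x / z)) *
            ennreal (inverse \<bar>z\<bar>) \<partial>lborel)
       = ennreal (even_density (2 * N) (transform h) x)"
proof -
  define F where "F z = even_density N h z * even_density 2 arcsine_profile (x / z) * inverse \<bar>z\<bar>" for z
  have Fm [measurable]: "F \<in> borel_measurable borel"
    unfolding F_def
    by (intro borel_measurable_times borel_measurable_inverse
        measurable_compose[OF _ even_density_measurable] h tame_arcsine_profile) measurable
  have F0: "0 \<le> F z" for z
    using even_density_nonneg[OF h] even_density_nonneg[OF tame_arcsine_profile] by (simp add: F_def)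
  have F_eq: "F z = 0" if "\<bar>z\<bar> \<le> \<bar>x\<bar> / 2 \<or> N \<le> \<bar>z\<bar>" for z
    using that by (cases "z = 0") (auto simp: F_def even_density_def field_simps)
  have "(\<integral>\<^sup>+z. ennreal (even_density N h z) * ennreal (even_density 2 arcsine_profile (x / z)) *
            ennreal (inverse \<bar>z\<bar>) \<partial>lborel) = (\<integral>\<^sup>+z. ennreal (F z) \<partial>lborel)"
    using even_density_nonneg[OF h] even_density_nonneg[OF tame_arcsine_profile]
    by (simp add: F_def ennreal_mult)
  also have "\<dots> = ennreal (even_density (2 * N) (transform h) x)"
  proof (cases "0 < \<bar>x\<bar> \<and> \<bar>x\<bar> < 2 * N")
    case False
    \<comment> \<open>For \<open>x = 0\<close> the second density is evaluated at 0, where it is 0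
      by definition. For |x| at least 2N, every z satisfies one of the two conditions in
      \<open>F_eq\<close>.\<close>
    have "F z = 0" for z
    proof (cases "x = 0")
      case True then show ?thesis by (simp add: F_def even_density_def)
    next
      case nz: False
      then show ?thesis using False by (intro F_eq) auto
    qed
    then show ?thesis using False by (auto simp: even_density_def)
  next
    case x: True
    define y where "y = 1 - (x / (2 * N))\<^sup>2"
    have y: "0 < y" "y < 1" using one_minus_square_unit[of x "2 * N"] x by (auto simp: y_def)
    \<comment> \<open>By evenness it suffices to integrate over the negative half line, where the substitution
      is increasing, as the substitution rule requires.\<close>
    \<comment> \<open>By evenness it suffices to integrate over the negative half line, where the substitution
      is increasing, as the substitution rule requires.\<close>
    define g where "g v = - N * sqrt (1 - y * v)" for v
    define g' where "g' v = N * y / (2 * sqrt (1 - y * v))" for v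
    have pos: "0 < 1 - y * v" if "0 \<le> v" "v \<le> 1" for v
      using y mult_left_le[of v y] that by linarith
    \<comment> \<open>At \<open>v = 1\<close> the root is \<open>sqrt (1 - y)\<close>, which is
      |x|/(2N) by the choice of y.\<close>
    have g01: "g 0 = - N" "g 1 = - \<bar>x\<bar> / 2"
      using N by (simp_all add: g_def y_def real_sqrt_abs abs_divide)
    have "(\<integral>\<^sup>+z. ennreal (F z) \<partial>lborel) = 2 * (\<integral>\<^sup>+z. ennreal (F z) * indicator {..<0} z \<partial>lborel)"
    proof (rule nn_integral_even)
      show "ennreal (F (- z)) = ennreal (F z)" for z
        using even_density_minus[of 2 arcsine_profile "x / z"] by (simp add: F_def)
    qed measurable
    also have "(\<integral>\<^sup>+z. ennreal (F z) * indicator {..<0} z \<partial>lborel)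
        = (\<integral>\<^sup>+z. ennreal (F z) * indicator {g 0..g 1} z \<partial>lborel)"
      unfolding g01 using x N F_eq
      by (intro nn_integral_cong) (auto simp: indicator_def)
    also have "\<dots> = (\<integral>\<^sup>+v. ennreal (F (g v)) * ennreal (g' v) * indicator {0..1} v \<partial>lborel)"
    proof (rule nn_integral_substitution_aux)
      fix v :: real assume v: "v \<in> {0..1}"
      show "(g has_real_derivative g' v) (at v)"
        unfolding g_def g'_def using pos[of v] v
        by (auto intro!: derivative_eq_intros simp: field_simps)
      show "0 \<le> g' v" using pos[of v] v y N by (simp add: g'_def)
    next
      show "continuous_on {0..1} g'"
        unfolding g'_def using pos by (intro continuous_intros) (auto simp: less_le)
    qed auto
    also have "2 * \<dots> = (\<integral>\<^sup>+v. 2 * (ennreal (F (g v)) * ennreal (g' v) * indicator {0..1} v) \<partial>lborel)"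
    proof (rule nn_integral_cmult[symmetric])
      have [measurable]: "g \<in> borel_measurable borel" "g' \<in> borel_measurable borel"
        unfolding g_def g'_def by measurable
      show "(\<lambda>v. ennreal (F (g v)) * ennreal (g' v) * indicator {0..1} v) \<in> borel_measurable lborel"
        by measurable
    qed
    also have "\<dots> = (\<integral>\<^sup>+v. ennreal (sqrt y / (2 * pi) * (indicator {0<..<1} v *\<^sub>R beta_kernel h y v)) \<partial>lborel)"
    proof (rule nn_integral_cong_AE)
      have eq: "2 * (ennreal (F (g v)) * ennreal (g' v)) = ennreal (sqrt y / (2 * pi) * beta_kernel h y v)"
        if v: "0 < v" "v < 1" for v
      proof -
        have m: "0 < y * v" "y * v < 1" "y * v < y" using mult_in_unit[of y v] y v by auto
        have "even_density N h (g v) = h (y * v)"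
          using N m by (simp add: even_density_def g_def power_mult_distrib power_divide)
        moreover have "even_density 2 arcsine_profile (x / g v)
            = sqrt (1 - y * v) / (2 * pi * sqrt y * sqrt (1 - v))"
        proof -
          \<comment> \<open>In these terms \<open>(x / g v / 2)^2\<close> is
            \<open>(1 - y) / (1 - y * v)\<close>, free of N. The arcsine factor thus contributes the
            \<open>1 / sqrt (1 - v)\<close> of the kernel.\<close>
          have x2: "x\<^sup>2 = (1 - y) * (4 * N\<^sup>2)"
            using N by (simp add: y_def power_divide power_mult_distrib)
          have "1 - (x / g v / 2)\<^sup>2 = 1 - (1 - y) / (1 - y * v)"
            using N m by (simp add: g_def power_divide power_mult_distrib x2)
          also have "\<dots> = y * (1 - v) / (1 - y * v)" using m by (simp add: field_simps)
          finally have *: "1 - (x / g v / 2)\<^sup>2 = y * (1 - v) / (1 - y * v)" .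
          have "0 < y * (1 - v) / (1 - y * v)" using y v m by simp
          then have "(x / g v / 2)\<^sup>2 < 1" using * by linarith
          then have "\<bar>x / g v / 2\<bar> < 1" by (simp only: abs_square_less_1)
          moreover have "\<bar>t / 2\<bar> < 1 \<Longrightarrow> \<bar>t\<bar> < 2" for t :: real by simp
          ultimately have "\<bar>x / g v\<bar> < 2" by blast
          moreover have "0 < \<bar>x / g v\<bar>" using x N m by (simp add: g_def)
          ultimately have "even_density 2 arcsine_profile (x / g v)
              = arcsine_profile (y * (1 - v) / (1 - y * v))"
            unfolding even_density_def * by simp
          then show ?thesis by (simp add: arcsine_profile_def real_sqrt_mult real_sqrt_divide)
        qed
        moreover have "inverse \<bar>g v\<bar> = 1 / (N * sqrt (1 - y * v))"
          using N m by (simp add: g_def abs_mult inverse_eq_divide)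
        ultimately have "2 * (F (g v) * g' v)
            = 2 * (h (y * v) * (sqrt (1 - y * v) / (2 * pi * sqrt y * sqrt (1 - v))) * (1 / (N * sqrt (1 - y * v)))
                * (N * y / (2 * sqrt (1 - y * v))))"
          by (simp add: F_def g'_def)
        \<comment> \<open>The 2 from evenness cancels the 2 in \<open>g'\<close>, and N cancels
          against \<open>inverse \<bar>g v\<bar>\<close>. Of the three roots of
          \<open>1 - y * v\<close>, one survives in the denominator.\<close>
        also have "\<dots> = h (y * v) * (y / sqrt y) / (2 * pi * sqrt (1 - v) * sqrt (1 - y * v))"
          using N m v y by (simp add: field_simps)
        also have "\<dots> = sqrt y / (2 * pi) * beta_kernel h y v"
          using y by (simp add: real_div_sqrt beta_kernel_def real_sqrt_mult mult_ac)
        finally have val: "2 * (F (g v) * g' v) = sqrt y / (2 * pi) * beta_kernel h y v" .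
        have "ennreal (2 * (F (g v) * g' v)) = ennreal 2 * ennreal (F (g v) * g' v)"
          by (rule ennreal_mult') simp
        also have "ennreal (F (g v) * g' v) = ennreal (F (g v)) * ennreal (g' v)"
          using F0 by (rule ennreal_mult')
        finally show ?thesis unfolding val by simp
      qed
      \<comment> \<open>The closed interval of the substitution and the open one of the operator
        differ by the null set {0, 1}.\<close>
      show "AE v in lborel. 2 * (ennreal (F (g v)) * ennreal (g' v) * indicator {0..1} v)
          = ennreal (sqrt y / (2 * pi) * (indicator {0<..<1} v *\<^sub>R beta_kernel h y v))"
        using AE_lborel_singleton[of "0::real"] AE_lborel_singleton[of "1::real"]
      proof eventually_elim
        case (elim v)
        show ?case
        proof (cases "0 < v \<and> v < 1")
          case True
          then have "indicator {0..1} v = (1 :: ennreal)" "indicator {0<..<1} v = (1 :: real)" by auto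
          with True show ?thesis by (simp only: mult_1_right scaleR_one eq)
        next
          case False
          then have "v \<notin> {0..1}" "v \<notin> {0<..<1}" using elim by auto
          then show ?thesis
            by (simp only: indicator_def of_bool_eq(1) mult_zero_right scaleR_zero_left ennreal_0)
        qed
      qed
    qed
    also have "\<dots> = ennreal (\<integral>v. sqrt y / (2 * pi) * (indicator {0<..<1} v *\<^sub>R beta_kernel h y v) \<partial>lborel)"
    proof (rule nn_integral_eq_integral)
      show "integrable lborel (\<lambda>v. sqrt y / (2 * pi) * (indicator {0<..<1} v *\<^sub>R beta_kernel h y v))"
        using beta_kernel_integrable[OF h y] unfolding set_integrable_def by (rule integrable_mult_right)
      show "AE v in lborel. 0 \<le> sqrt y / (2 * pi) * (indicator {0<..<1} v *\<^sub>R beta_kernel h y v)"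
      proof (rule AE_I2)
        fix v :: real
        have "0 \<le> indicator {0<..<1} v *\<^sub>R beta_kernel h y v"
          using beta_kernel_nonneg[OF h y, of v] by (cases "v \<in> {0<..<1}") auto
        then show "0 \<le> sqrt y / (2 * pi) * (indicator {0<..<1} v *\<^sub>R beta_kernel h y v)"
          using y by (intro mult_nonneg_nonneg) auto
      qed
    qed
    also have "\<dots> = ennreal (transform h y)"
      by (simp add: transform_def set_lebesgue_integral_def)
    also have "transform h y = even_density (2 * N) (transform h) x"
      using x by (simp add: even_density_def y_def)
    finally show ?thesis .
  qed
  finally show ?thesis .
qed

section \<open>Density of a product of two independent real variables\<close>

text \<open>By independence the joint density factors. For fixed nonzero z the substitution
  \<open>w = x / z\<close> has Jacobian 1/|z|, and Tonelli then moves the integral over x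
  outside.\<close>

lemma (in prob_space) distributed_mult:
  fixes Z W :: "'a \<Rightarrow> real"
  assumes indep: "indep_var borel W borel Z"
    and Z: "distributed M lborel Z f" and W: "distributed M lborel W g"
  shows "distributed M lborel (\<lambda>\<omega>. Z \<omega> * W \<omega>) (\<lambda>x. \<integral>\<^sup>+z. f z * g (x / z) * ennreal (inverse \<bar>z\<bar>) \<partial>lborel)"
proof -
  have [measurable]: "f \<in> borel_measurable borel" "g \<in> borel_measurable borel"
    "Z \<in> borel_measurable M" "W \<in> borel_measurable M"
    using distributed_borel_measurable[OF Z] distributed_borel_measurable[OF W]
      distributed_measurable[OF Z] distributed_measurable[OF W] by simp_all
  let ?k = "\<lambda>x. \<integral>\<^sup>+z. f z * g (x / z) * ennreal (inverse \<bar>z\<bar>) \<partial>lborel"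
  \<comment> \<open>\<open>borel\<close> and \<open>lborel\<close> have the same measurable sets, so
    independence carries over.\<close>
  have "indep_var lborel W lborel Z"
    using indep by (simp add: indep_var_def indep_vars_def2 case_bool_if cong: if_cong)
  then have joint: "distributed M (lborel \<Otimes>\<^sub>M lborel) (\<lambda>\<omega>. (W \<omega>, Z \<omega>)) (\<lambda>(w, z). g w * f z)"
    by (intro distributed_joint_indep sigma_finite_lborel Z W)
  have "distr M lborel (\<lambda>\<omega>. Z \<omega> * W \<omega>) = density lborel ?k"
  proof (rule measure_eqI)
    fix A assume "A \<in> sets (distr M lborel (\<lambda>\<omega>. Z \<omega> * W \<omega>))"
    then have A [measurable]: "A \<in> sets borel" by simp
    have "emeasure (distr M lborel (\<lambda>\<omega>. Z \<omega> * W \<omega>)) A = (\<integral>\<^sup>+\<omega>. indicator A (Z \<omega> * W \<omega>) \<partial>M)"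
      using nn_integral_distr[of "\<lambda>\<omega>. Z \<omega> * W \<omega>" M lborel "indicator A"] by simp
    also have "\<dots> = (\<integral>\<^sup>+p. (case p of (w, z) \<Rightarrow> g w * f z) * indicator A (snd p * fst p) \<partial>(lborel \<Otimes>\<^sub>M lborel))"
      by (subst distributed_nn_integral[OF joint]) auto
    also have "\<dots> = (\<integral>\<^sup>+z. (\<integral>\<^sup>+w. f z * g w * indicator A (z * w) \<partial>lborel) \<partial>lborel)"
      by (subst lborel_pair.nn_integral_snd[symmetric]) (auto simp: split_beta' mult.commute)
    also have "\<dots> = (\<integral>\<^sup>+z. (\<integral>\<^sup>+x. f z * g (x / z) * ennreal (inverse \<bar>z\<bar>) * indicator A x \<partial>lborel) \<partial>lborel)"
    proof (rule nn_integral_cong_AE)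
      have "(\<integral>\<^sup>+w. f z * g w * indicator A (z * w) \<partial>lborel)
          = (\<integral>\<^sup>+x. f z * g (x / z) * ennreal (inverse \<bar>z\<bar>) * indicator A x \<partial>lborel)" if "z \<noteq> 0" for z
        using that
        by (subst nn_integral_real_affine[where c = "1 / z" and t = 0])
          (auto simp: nn_integral_cmult[symmetric] field_simps intro!: nn_integral_cong)
      then show "AE z in lborel. (\<integral>\<^sup>+w. f z * g w * indicator A (z * w) \<partial>lborel)
          = (\<integral>\<^sup>+x. f z * g (x / z) * ennreal (inverse \<bar>z\<bar>) * indicator A x \<partial>lborel)"
        using AE_lborel_singleton[of "0::real"] by auto
    qed
    also have "\<dots> = (\<integral>\<^sup>+x. (\<integral>\<^sup>+z. f z * g (x / z) * ennreal (inverse \<bar>z\<bar>) * indicator A x \<partial>lborel) \<partial>lborel)"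
      by (rule lborel_pair.Fubini') measurable
    also have "\<dots> = (\<integral>\<^sup>+x. ?k x * indicator A x \<partial>lborel)"
      by (simp add: nn_integral_multc)
    also have "\<dots> = emeasure (density lborel ?k) A"
      by (simp add: emeasure_density)
    finally show "emeasure (distr M lborel (\<lambda>\<omega>. Z \<omega> * W \<omega>)) A = emeasure (density lborel ?k) A" .
  qed simp
  then show ?thesis by (simp add: distributed_def)
qed

section \<open>The arcsine law of a single factor\<close>

text \<open>Replacing t by \<open>pi - t\<close> on the first half period and by
  \<open>pi + t\<close> on the second turns \<open>2 * cos t\<close> into \<open>- 2 * cos t\<close>
  on \<open>{0..pi}\<close>. That function is increasing, as the substitution rule requires.\<close>

lemma nn_integral_2cos:
  assumes A [measurable]: "A \<in> sets borel"
  shows "(\<integral>\<^sup>+t. indicator A (2 * cos t) * indicator {0..2 * pi} t \<partial>lborel)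
       = 2 * (\<integral>\<^sup>+t. indicator A (- 2 * cos t) * indicator {0..pi} t \<partial>lborel)"
proof -
  have "(\<integral>\<^sup>+t. indicator A (2 * cos t) * indicator {0..2 * pi} t \<partial>lborel)
      = (\<integral>\<^sup>+t. indicator A (2 * cos t) * indicator {0..pi} t
          + indicator A (2 * cos t) * indicator {pi<..2 * pi} t \<partial>lborel)"
    by (intro nn_integral_cong) (auto simp: indicator_def)
  also have "\<dots> = (\<integral>\<^sup>+t. indicator A (2 * cos t) * indicator {0..pi} t \<partial>lborel)
      + (\<integral>\<^sup>+t. indicator A (2 * cos t) * indicator {pi<..2 * pi} t \<partial>lborel)"
    by (intro nn_integral_add) measurable
  also have "(\<integral>\<^sup>+t. indicator A (2 * cos t) * indicator {0..pi} t \<partial>lborel)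
      = (\<integral>\<^sup>+t. indicator A (- 2 * cos t) * indicator {0..pi} t \<partial>lborel)"
    by (subst nn_integral_real_affine[where c = "-1" and t = pi])
      (auto simp: indicator_def cos_diff intro!: nn_integral_cong)
  also have "(\<integral>\<^sup>+t. indicator A (2 * cos t) * indicator {pi<..2 * pi} t \<partial>lborel)
      = (\<integral>\<^sup>+t. indicator A (- 2 * cos t) * indicator {0<..pi} t \<partial>lborel)"
    by (subst nn_integral_real_affine[where c = 1 and t = pi])
      (auto simp: indicator_def cos_add intro!: nn_integral_cong)
  also have "\<dots> = (\<integral>\<^sup>+t. indicator A (- 2 * cos t) * indicator {0..pi} t \<partial>lborel)"
  proof (rule nn_integral_cong_AE)
    show "AE t in lborel. indicator A (- 2 * cos t) * indicator {0<..pi} t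
        = (indicator A (- 2 * cos t) * indicator {0..pi} t :: ennreal)"
      using AE_lborel_singleton[of "0::real"]
    proof eventually_elim
      case (elim t)
      then have "(indicator {0<..pi} t :: ennreal) = indicator {0..pi} t"
        by (simp add: indicator_def)
      then show ?case by (simp only:)
    qed
  qed
  finally show ?thesis by (simp only: mult_2)
qed

text \<open>At \<open>- 2 * cos t\<close> the arcsine density is
  \<open>1 / (2 * pi * sin t)\<close>, and the derivative of \<open>- 2 * cos t\<close> is
  \<open>2 * sin t\<close>. Their product \<open>1 / pi\<close> is twice the uniform density,
  matching the two half periods.\<close>

lemma distr_2cos:
  "distr (uniform_measure lborel {0..2 * pi}) borel (\<lambda>t. 2 * cos t)
    = density lborel (\<lambda>x. ennreal (even_density 2 arcsine_profile x))"
proof (rule measure_eqI)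
  fix A assume "A \<in> sets (distr (uniform_measure lborel {0..2 * pi}) borel (\<lambda>t. 2 * cos t))"
  then have A [measurable]: "A \<in> sets borel" by simp
  have dm [measurable]: "even_density 2 arcsine_profile \<in> borel_measurable borel"
    by (rule even_density_measurable[OF tame_arcsine_profile])
  let ?I = "\<integral>\<^sup>+t. indicator A (- 2 * cos t) * indicator {0..pi} t \<partial>lborel"
  let ?d = "\<lambda>x. ennreal (even_density 2 arcsine_profile x)"
  have "emeasure (distr (uniform_measure lborel {0..2 * pi}) borel (\<lambda>t. 2 * cos t)) A
      = emeasure lborel ({0..2 * pi} \<inter> (\<lambda>t. 2 * cos t) -` A) / ennreal (2 * pi)"
    using measurable_sets_borel[of "\<lambda>t::real. 2 * cos t" borel A]
    by (subst emeasure_distr)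
      (auto simp: measurable_cong_sets[OF sets_uniform_measure refl] emeasure_uniform_measure)
  also have "emeasure lborel ({0..2 * pi} \<inter> (\<lambda>t. 2 * cos t) -` A)
      = (\<integral>\<^sup>+t. indicator ({0..2 * pi} \<inter> (\<lambda>t. 2 * cos t) -` A) t \<partial>lborel)"
    by (rule nn_integral_indicator[symmetric]) simp
  also have "\<dots> = (\<integral>\<^sup>+t. indicator A (2 * cos t) * indicator {0..2 * pi} t \<partial>lborel)"
    by (intro nn_integral_cong) (auto simp: indicator_def)
  also have "\<dots> = 2 * ?I" by (rule nn_integral_2cos) simp
  also have "2 * ?I / ennreal (2 * pi) = ennreal (1 / pi) * ?I"
  proof -
    have "2 * ?I / ennreal (2 * pi) = ?I * (ennreal 2 * ennreal (inverse (2 * pi)))"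
      by (simp add: divide_ennreal_def inverse_ennreal mult_ac)
    also have "ennreal 2 * ennreal (inverse (2 * pi)) = ennreal (1 / pi)"
      by (subst ennreal_mult[symmetric]) (auto simp: field_simps)
    finally show ?thesis by (simp add: mult.commute)
  qed
  also have "\<dots> = (\<integral>\<^sup>+t. ennreal (1 / pi) * (indicator A (- 2 * cos t) * indicator {0..pi} t) \<partial>lborel)"
    by (rule nn_integral_cmult[symmetric]) measurable
  also have "\<dots> = (\<integral>\<^sup>+t. ?d (- 2 * cos t) * indicator A (- 2 * cos t) * ennreal (2 * sin t)
      * indicator {0..pi} t \<partial>lborel)"
  proof (rule nn_integral_cong_AE)
    \<comment> \<open>The point \<open>pi / 2\<close> is excluded because there
      \<open>- 2 * cos t\<close> is 0, where \<open>even_density\<close> is set to 0.\<close>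
    have eq: "?d (- 2 * cos t) * ennreal (2 * sin t) = ennreal (1 / pi)"
      if t: "0 < t" "t < pi" "t \<noteq> pi / 2" for t
    proof -
      have s: "0 < sin t" using t by (intro sin_gt_zero)
      have "(cos t)\<^sup>2 < 1" using s by (simp add: cos_squared_eq)
      then have "\<bar>cos t\<bar> < 1" by (simp add: abs_square_less_1)
      moreover have "cos t \<noteq> 0"
        using t cos_zero_iff cos_inj_pi[of t "pi / 2"] by auto
      moreover have "sqrt (1 - (cos t)\<^sup>2) = sin t"
        using s by (simp add: sin_squared_eq[symmetric])
      ultimately have "even_density 2 arcsine_profile (- 2 * cos t) = 1 / (2 * pi * sin t)"
        by (simp add: even_density_def arcsine_profile_def)
      then have "even_density 2 arcsine_profile (- 2 * cos t) * (2 * sin t) = 1 / pi"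
        using s by simp
      then show ?thesis
        using s ennreal_mult''[of "2 * sin t" "even_density 2 arcsine_profile (- 2 * cos t)"] by simp
    qed
    show "AE t in lborel. ennreal (1 / pi) * (indicator A (- 2 * cos t) * indicator {0..pi} t)
       = ?d (- 2 * cos t) * indicator A (- 2 * cos t) * ennreal (2 * sin t) * indicator {0..pi} t"
      using AE_lborel_singleton[of "0::real"] AE_lborel_singleton[of pi] AE_lborel_singleton[of "pi / 2"]
    proof eventually_elim
      case (elim t)
      then show ?case using eq[of t] by (auto simp: indicator_def)
    qed
  qed
  also have "\<dots> = (\<integral>\<^sup>+x. ?d x * indicator A x * indicator {- 2 * cos 0..- 2 * cos pi} x \<partial>lborel)"
    by (rule nn_integral_substitution_aux[symmetric])
      (auto intro!: derivative_eq_intros continuous_intros sin_ge_zero)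
  also have "\<dots> = (\<integral>\<^sup>+x. ?d x * indicator A x \<partial>lborel)"
    by (intro nn_integral_cong) (auto simp: indicator_def even_density_def)
  also have "\<dots> = emeasure (density lborel ?d) A"
    by (simp add: emeasure_density)
  finally show "emeasure (distr (uniform_measure lborel {0..2 * pi}) borel (\<lambda>t. 2 * cos t)) A
      = emeasure (density lborel ?d) A" .
qed simp

section \<open>Densities of the circle products by iteration\<close>

text \<open>The index is shifted: \<open>profile n\<close> is the candidate for \<open>G\<close>
  with \<open>n + 1\<close> factors.\<close>

primrec profile :: "nat \<Rightarrow> real \<Rightarrow> real" where
  "profile 0 = arcsine_profile"
| "profile (Suc n) = transform (profile n)"

lemma tame_profile: "tame (profile n)"
  by (induction n) (simp_all add: tame_arcsine_profile tame_transform)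

context prob_space
begin

lemma distributed_re_circle:
  assumes X: "X \<in> borel_measurable M" and D: "distr M borel X = unit_circle_uniform"
  shows "distributed M lborel (\<lambda>\<omega>. Re (X \<omega> + inverse (X \<omega>)))
     (\<lambda>x. ennreal (even_density 2 arcsine_profile x))"
proof -
  have cis [measurable]: "cis \<in> borel_measurable borel"
    by (auto intro!: borel_measurable_continuous_onI continuous_on_cis continuous_on_id)
  note [measurable] = X even_density_measurable[OF tame_arcsine_profile]
  let ?f = "\<lambda>z. Re (z + inverse z)"
  have "distr M lborel (\<lambda>\<omega>. ?f (X \<omega>)) = distr M borel (\<lambda>\<omega>. ?f (X \<omega>))"
    by (rule distr_cong) auto
  also have "\<dots> = distr (distr M borel X) borel ?f"
    by (subst distr_distr) (auto simp: comp_def)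
  also have "\<dots> = distr (uniform_measure lborel {0..2 * pi}) borel (?f \<circ> cis)"
    unfolding D unit_circle_uniform_def
    by (rule distr_distr) (auto simp: measurable_cong_sets[OF sets_uniform_measure refl])
  also have "?f \<circ> cis = (\<lambda>t. 2 * cos t)"
    by (auto simp: cis_inverse)
  finally show ?thesis by (simp add: distributed_def distr_2cos)
qed

text \<open>Induction on the number of factors, each step multiplying by an independent arcsine
  variable. The real part is taken in each factor because this product splits at every sample point,
  whereas the real part of a complex product does so only when the factors are real.\<close>

lemma distributed_prod_re_circle:
  assumes indep: "indep_vars (\<lambda>_. borel) X {1..Suc n}"
    and D: "\<And>i. i \<in> {1..Suc n} \<Longrightarrow> distr M borel (X i) = unit_circle_uniform"
  shows "distributed M lborel (\<lambda>\<omega>. \<Prod>i = 1..Suc n. Re (X i \<omega> + inverse (X i \<omega>)))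
     (\<lambda>x. ennreal (even_density (2 ^ Suc n) (profile n) x))"
  using assms
proof (induction n)
  case 0
  then show ?case using distributed_re_circle[of "X 1"] by (simp add: indep_vars_def)
next
  case (Suc n)
  define W where "W i \<omega> = Re (X i \<omega> + inverse (X i \<omega>))" for i \<omega>
  \<comment> \<open>The index set is written as an \<open>insert\<close> so that the last factor is
    seen to be independent of the product of the others.\<close>
  have W: "indep_vars (\<lambda>_. borel) W (insert (Suc (Suc n)) {1..Suc n})"
  proof -
    have "indep_vars (\<lambda>_. borel) (\<lambda>i \<omega>. Re (X i \<omega> + inverse (X i \<omega>))) {1..Suc (Suc n)}"
      by (rule indep_vars_compose2[OF Suc.prems(1)]) measurable
    also have "{1..Suc (Suc n)} = insert (Suc (Suc n)) {1..Suc n}" by auto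
    finally show ?thesis by (simp add: W_def[abs_def])
  qed
  have prev: "distributed M lborel (\<lambda>\<omega>. \<Prod>i = 1..Suc n. W i \<omega>)
     (\<lambda>x. ennreal (even_density (2 ^ Suc n) (profile n) x))"
    unfolding W_def
    by (rule Suc.IH) (use Suc.prems in \<open>auto intro: indep_vars_subset\<close>)
  have last: "distributed M lborel (W (Suc (Suc n))) (\<lambda>x. ennreal (even_density 2 arcsine_profile x))"
    unfolding W_def using Suc.prems by (intro distributed_re_circle) (auto simp: indep_vars_def)
  have "indep_var borel (W (Suc (Suc n))) borel (\<lambda>\<omega>. \<Prod>i = 1..Suc n. W i \<omega>)"
    by (rule indep_vars_prod[OF _ _ W]) auto
  from distributed_mult[OF this prev last]
  show ?case
    by (simp add: nn_integral_even_density_mult[OF tame_profile] W_def)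
qed

text \<open>Almost surely every \<open>X i\<close> lies on the unit circle, so every factor is real
  and \<open>circle_prod\<close> equals the product of the real parts.\<close>

lemma distributed_circle_prod:
  assumes indep: "indep_vars (\<lambda>_. borel) X {1..Suc n}"
    and D: "\<And>i. i \<in> {1..Suc n} \<Longrightarrow> distr M borel (X i) = unit_circle_uniform"
  shows "distributed M lborel (circle_prod X (Suc n))
     (\<lambda>x. ennreal (even_density (2 ^ Suc n) (profile n) x))"
proof -
  have X [measurable]: "X i \<in> borel_measurable M" if "i \<in> {1..Suc n}" for i
    using indep that by (auto simp: indep_vars_def)
  have norm1: "AE \<omega> in M. norm (X i \<omega>) = 1" if i: "i \<in> {1..Suc n}" for i
  proof -
    have cis: "cis \<in> borel_measurable (uniform_measure lborel {0..2 * pi})"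
      by (auto intro!: borel_measurable_continuous_onI continuous_on_cis continuous_on_id
          simp: measurable_cong_sets[OF sets_uniform_measure refl])
    have "AE z in distr M borel (X i). norm z = 1"
      unfolding D[OF i] unit_circle_uniform_def using cis by (subst AE_distr_iff) auto
    then show ?thesis using X[OF i] by (subst (asm) AE_distr_iff) auto
  qed
  have "AE \<omega> in M. \<forall>i\<in>{1..Suc n}. norm (X i \<omega>) = 1"
    using norm1 by (intro AE_finite_allI) auto
  then have ae: "AE \<omega> in M. circle_prod X (Suc n) \<omega> = (\<Prod>i = 1..Suc n. Re (X i \<omega> + inverse (X i \<omega>)))"
  proof eventually_elim
    case (elim \<omega>)
    have "complex_of_real (circle_prod X (Suc n) \<omega>) = (\<Prod>i = 1..Suc n. X i \<omega> + inverse (X i \<omega>))"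
      using elim by (intro circle_prod_eq) auto
    also have "\<dots> = (\<Prod>i = 1..Suc n. complex_of_real (Re (X i \<omega> + inverse (X i \<omega>))))"
    proof (rule prod.cong[OF refl])
      fix i assume "i \<in> {1..Suc n}"
      \<comment> \<open>A one-factor \<open>circle_prod\<close> yields from
        \<open>circle_prod_eq\<close> that the single factor is real.\<close>
      then have "circle_prod (\<lambda>_. X i) 1 \<omega> = Re (X i \<omega> + inverse (X i \<omega>))"
        "complex_of_real (circle_prod (\<lambda>_. X i) 1 \<omega>) = X i \<omega> + inverse (X i \<omega>)"
        using elim circle_prod_eq[of 1 "\<lambda>_. X i" \<omega>] by (simp_all add: circle_prod_def)
      then show "X i \<omega> + inverse (X i \<omega>) = complex_of_real (Re (X i \<omega> + inverse (X i \<omega>)))"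
        by simp
    qed
    finally show ?case by (simp only: of_real_prod[symmetric] of_real_eq_iff)
  qed
  have m: "circle_prod X (Suc n) \<in> borel_measurable M"
  proof -
    have "(\<lambda>\<omega>. \<Prod>i = 1..Suc n. X i \<omega> + inverse (X i \<omega>)) \<in> borel_measurable M"
      by (intro borel_measurable_prod borel_measurable_add borel_measurable_inverse X)
    then show ?thesis unfolding circle_prod_def by measurable
  qed
  note P = distributed_prod_re_circle[OF indep D]
  have "distr M lborel (circle_prod X (Suc n))
      = distr M lborel (\<lambda>\<omega>. \<Prod>i = 1..Suc n. Re (X i \<omega> + inverse (X i \<omega>)))"
    using m distributed_measurable[OF P] by (intro distr_cong_AE ae refl) auto
  then show ?thesis using P m by (simp add: distributed_def)
qed

text \<open>This existence result is what makes the choice in \<open>hat_p\<close> return a function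
  satisfying \<open>is_hat_p\<close>.\<close>

lemma is_hat_p_even_density:
  assumes "indep_vars (\<lambda>_. borel) X {1..Suc n}"
    and "\<And>i. i \<in> {1..Suc n} \<Longrightarrow> distr M borel (X i) = unit_circle_uniform"
  shows "is_hat_p M X (Suc n) (even_density (2 ^ Suc n) (profile n))"
  unfolding is_hat_p_def
  using distributed_circle_prod[OF assms] even_density_nonneg[OF tame_profile]
    even_density_continuous[OF tame_profile]
  by (auto simp: even_density_def)

section \<open>Uniqueness of the continuous density and identification with \<open>G\<close>\<close>

text \<open>By continuity, a difference at one point persists on a nonempty open set, which is not
  null, whereas two densities of one variable agree almost everywhere.\<close>

lemma is_hat_p_unique:
  assumes p: "is_hat_p M X r p" and q: "is_hat_p M X r q" and x: "0 < x" "x < 2 ^ r"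
  shows "p x = q x"
proof (rule ccontr)
  assume "p x \<noteq> q x"
  let ?D = "{0<..<2 ^ r} \<inter> (\<lambda>z. p z - q z) -` (- {0})"
  have "continuous_on {0<..<2 ^ r} (\<lambda>z. p z - q z)"
    using p q by (intro continuous_intros) (auto simp: is_hat_p_def)
  then have "open ?D"
    by (rule continuous_open_preimage) auto
  moreover have "x \<in> ?D" using \<open>p x \<noteq> q x\<close> x by simp
  ultimately have "\<not> negligible ?D" using open_not_negligible by blast
  moreover have "AE z in lborel. ennreal (p z) = ennreal (q z)"
    using p q by (intro distributed_unique[of lborel "circle_prod X r"]) (auto simp: is_hat_p_def)
  then have "AE z in lborel. z \<notin> ?D"
  proof eventually_elim
    case (elim z)
    \<comment> \<open>Both functions are nonnegative, so equality of the \<open>ennreal\<close>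
      values gives equality of the reals.\<close>
    then have "p z = q z" using p q by (simp add: is_hat_p_def)
    then show ?case by simp
  qed
  then have "?D \<in> null_sets lborel"
    using \<open>open ?D\<close> by (subst AE_iff_null_sets) auto
  then have "negligible ?D"
    unfolding negligible_iff_null_sets by (rule null_sets_completionI)
  ultimately show False by blast
qed

lemma G_eq_profile:
  assumes "indep_vars (\<lambda>_. borel) X {1..Suc n}"
    and "\<And>i. i \<in> {1..Suc n} \<Longrightarrow> distr M borel (X i) = unit_circle_uniform"
    and y: "0 < y" "y < 1"
  shows "G M X (Suc n) y = profile n y"
proof -
  let ?x = "2 ^ Suc n * sqrt (1 - y)"
  have q: "is_hat_p M X (Suc n) (even_density (2 ^ Suc n) (profile n))"
    using assms by (intro is_hat_p_even_density)
  then have p: "is_hat_p M X (Suc n) (hat_p M X (Suc n))"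
    unfolding hat_p_def by (rule someI[where P = "is_hat_p M X (Suc n)"])
  have x: "0 < ?x" "?x < 2 ^ Suc n" using y by auto
  have "G M X (Suc n) y = even_density (2 ^ Suc n) (profile n) ?x"
    unfolding G_def by (rule is_hat_p_unique[OF p q x])
  also have "\<dots> = profile n y"
    using x y by (simp add: even_density_def power_mult_distrib)
  finally show ?thesis .
qed

end

theorem theorem4p2:
  fixes M :: "'a measure" and X :: "nat \<Rightarrow> 'a \<Rightarrow> complex" and r :: nat and y :: real
  assumes "prob_space M"
    and "prob_space.indep_vars M (\<lambda>_. borel) X {1..r}"
    and "\<And>i. i \<in> {1..r} \<Longrightarrow> distr M borel (X i) = unit_circle_uniform"
    and "2 \<le> r" and "0 < y" and "y < 1"
  shows "set_integrable lborel {0<..<1}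
           (\<lambda>v. G M X (r - 1) (y * v) * (1 / sqrt ((1 - v) * (1 - y * v)))) \<and>
         G M X r y = sqrt y / (2 * pi) *
           (LBINT v:{0<..<1}. G M X (r - 1) (y * v) * (1 / sqrt ((1 - v) * (1 - y * v))))"
proof -
  interpret prob_space M by fact
  \<comment> \<open>With this offset \<open>G\<close> for \<open>r - 1\<close> is
    \<open>profile n\<close> and \<open>G\<close> for r is \<open>profile (Suc n)\<close>, one
    application of \<open>transform\<close> apart.\<close>
  define n where "n = r - 2"
  have r: "r = Suc (Suc n)"
    using \<open>2 \<le> r\<close> by (simp add: n_def)
  have indep: "indep_vars (\<lambda>_. borel) X {1..Suc n}"
    using assms(2) by (rule indep_vars_subset) (auto simp: r)
  \<comment> \<open>\<open>G\<close> is known to agree with the profile only on the open unit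
    interval, and \<open>y * v\<close> lies there for every v in the domain of integration.\<close>
  have prev: "G M X (r - 1) (y * v) * (1 / sqrt ((1 - v) * (1 - y * v))) = beta_kernel (profile n) y v"
    if "v \<in> {0<..<1}" for v
    using G_eq_profile[OF indep assms(3), of "y * v"] mult_in_unit[of y v] that assms(5,6)
    by (simp add: r beta_kernel_def)
  have "set_integrable lborel {0<..<1}
      (\<lambda>v. G M X (r - 1) (y * v) * (1 / sqrt ((1 - v) * (1 - y * v))))"
    using beta_kernel_integrable[OF tame_profile assms(5,6), of n]
    by (subst set_integrable_cong[OF refl refl prev]) auto
  moreover have "(LBINT v:{0<..<1}. G M X (r - 1) (y * v) * (1 / sqrt ((1 - v) * (1 - y * v))))
      = (LBINT v:{0<..<1}. beta_kernel (profile n) y v)"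
    by (intro set_lebesgue_integral_cong) (use prev in auto)
  moreover have "G M X r y = transform (profile n) y"
    using G_eq_profile[of X "Suc n" y] assms by (simp add: r)
  ultimately show ?thesis by (simp add: transform_def)
qed

end
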